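(* Let $G=(V,E)$ be a chordal graph with chromatic number $\chi$, and let $w:V\to\mathbb{R}$ be a cost function on its vertices. Let an intervention on a set $I\subseteq V$ have cost $\sum_{i\in I}w_i$. Then the optimal set of interventions with minimum total cost that can learn any causal graph $D$ with skeleton $G$ is given by $\mathcal{I}=\{I_i\}_{i\in[\chi]}$, where $\{I_i\}_{i\in[\chi]}$ is (the collection of color classes of) any $\chi$-coloring of the induced subgraph $G_{V\setminus S}$ of $G$ on $V\setminus S$, and $S$ is the maximum weighted independent set of $G$.
   Context: All graphs are finite. A causal graph is a directed acyclic graph (DAG) $D$. The skeleton of $D$ is the undirected graph obtained by forgetting edge directions. An immorality of $D$ is an induced subgraph of the form $X\to Z\leftarrow Y$ with $X,Y$ non-adjacent. A set of interventions (intervention design) for an undirected graph $G=(V,E)$ is a finite collection $\mathcal{I}=\{I_1,\dots,I_m\}$ of subsets of $V$ ($I_i$ is the set of vertices intervened on in the $i$-th experiment), fixed in advance (non-adaptively). The number $m$ of interventions is not bounded here. Given the skeleton and the immoralities of $D$, intervening on $I_i$ reveals the direction in $D$ of every edge with exactly one endpoint in $I_i$, after which the (complete) Meek rules orient every further edge whose direction is forced. Thus $\mathcal{I}$ learns the causal graph $D$ with skeleton $G$ if $D$ is the only DAG with skeleton $G$ that has the same immoralities as $D$ and that agrees with $D$ on the direction of every edge having, for some $i$, exactly one endpoint in $I_i$. $\mathcal{I}$ can learn any causal graph with skeleton $G$ if this holds for every DAG $D$ with skeleton $G$. The total cost of $\mathcal{I}$ is $\sum_{i=1}^m\sum_{j\in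 I_i}w_j$. A maximum weighted independent set is an independent set $S$ maximizing $\sum_{j\in S}w_j$. A $\chi$-coloring is a proper vertex coloring with $\chi$ available colors (some color classes may be empty). Notation: $[\chi]=\{1,\dots,\chi\}$.
   Formalization: The costs w are assumed nonnegative; if some vertex has negative cost, repeating the intervention on that vertex alone makes the total cost arbitrarily small, so no minimum-cost set of interventions exists and the claim fails. *)

theory Defs
  imports Complex_Main
begin

(* An undirected graph is a vertex set V together with a set E of two-element subsets of V;
   a directed graph on V is a relation D on V. *)

definition fin_graph :: "'a set \<Rightarrow> 'a set set \<Rightarrow> bool" where
  "fin_graph V E \<longleftrightarrow> finite V \<and> (\<forall>e\<in>E. e \<subseteq> V \<and> card e = 2)"

definition induced_edges :: "'a set set \<Rightarrow> 'a set \<Rightarrow> 'a set set" where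
  "induced_edges E W = {e \<in> E. e \<subseteq> W}"

definition cycle_edges :: "'a list \<Rightarrow> 'a set set" where
  "cycle_edges xs = {{xs ! i, xs ! (Suc i mod length xs)} | i. i < length xs}"

definition is_cycle :: "'a set set \<Rightarrow> 'a list \<Rightarrow> bool" where
  "is_cycle E xs \<longleftrightarrow> length xs \<ge> 3 \<and> distinct xs \<and> cycle_edges xs \<subseteq> E"

definition chordal :: "'a set set \<Rightarrow> bool" where
  "chordal E \<longleftrightarrow>
     (\<forall>xs. is_cycle E xs \<and> length xs \<ge> 4 \<longrightarrow> (\<exists>e\<in>E. e \<subseteq> set xs \<and> e \<notin> cycle_edges xs))"

(* The colors are 1, ..., k; not all of them need to be used. *)
definition proper_coloring :: "'a set \<Rightarrow> 'a set set \<Rightarrow> nat \<Rightarrow> ('a \<Rightarrow> nat) \<Rightarrow> bool" where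
  "proper_coloring V E k c \<longleftrightarrow>
     (\<forall>v\<in>V. c v \<in> {1..k}) \<and> (\<forall>x\<in>V. \<forall>y\<in>V. {x, y} \<in> E \<longrightarrow> c x \<noteq> c y)"

definition chromatic_number :: "'a set \<Rightarrow> 'a set set \<Rightarrow> nat" where
  "chromatic_number V E = (LEAST k. \<exists>c. proper_coloring V E k c)"

definition independent_set :: "'a set \<Rightarrow> 'a set set \<Rightarrow> 'a set \<Rightarrow> bool" where
  "independent_set V E S \<longleftrightarrow> S \<subseteq> V \<and> (\<forall>x\<in>S. \<forall>y\<in>S. {x, y} \<notin> E)"

definition max_weight_independent_set ::
    "'a set \<Rightarrow> 'a set set \<Rightarrow> ('a \<Rightarrow> real) \<Rightarrow> 'a set \<Rightarrow> bool" where
  "max_weight_independent_set V E w S \<longleftrightarrow>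
     independent_set V E S \<and> (\<forall>T. independent_set V E T \<longrightarrow> sum w T \<le> sum w S)"

definition skeleton :: "('a \<times> 'a) set \<Rightarrow> 'a set set" where
  "skeleton D = {{x, y} | x y. (x, y) \<in> D}"

definition causal_graph_with_skeleton :: "'a set \<Rightarrow> 'a set set \<Rightarrow> ('a \<times> 'a) set \<Rightarrow> bool" where
  "causal_graph_with_skeleton V E D \<longleftrightarrow> D \<subseteq> V \<times> V \<and> acyclic D \<and> skeleton D = E"

(* The triple (x, z, y) stands for x -> z <- y; each immorality occurs as (x, z, y) and (y, z, x). *)
definition immoralities :: "('a \<times> 'a) set \<Rightarrow> ('a \<times> 'a \<times> 'a) set" where
  "immoralities D =
     {(x, z, y). (x, z) \<in> D \<and> (y, z) \<in> D \<and> x \<noteq> y \<and> {x, y} \<notin> skeleton D}"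

(* A design I_1, ..., I_m is a list of arbitrary length m; repeated and empty interventions are
   allowed, and repeated ones are paid for each time. *)
definition design :: "'a set \<Rightarrow> 'a set list \<Rightarrow> bool" where
  "design V Is \<longleftrightarrow> (\<forall>I\<in>set Is. I \<subseteq> V)"

definition total_cost :: "('a \<Rightarrow> real) \<Rightarrow> 'a set list \<Rightarrow> real" where
  "total_cost w Is = (\<Sum>I\<leftarrow>Is. \<Sum>j\<in>I. w j)"

definition agree_on_cut_edges ::
    "'a set set \<Rightarrow> 'a set list \<Rightarrow> ('a \<times> 'a) set \<Rightarrow> ('a \<times> 'a) set \<Rightarrow> bool" where
  "agree_on_cut_edges E Is D D' \<longleftrightarrow>
     (\<forall>I\<in>set Is. \<forall>x y. {x, y} \<in> E \<and> x \<in> I \<and> y \<notin> I \<longrightarrow>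
        ((x, y) \<in> D \<longleftrightarrow> (x, y) \<in> D') \<and> ((y, x) \<in> D \<longleftrightarrow> (y, x) \<in> D'))"

definition learns :: "'a set \<Rightarrow> 'a set set \<Rightarrow> 'a set list \<Rightarrow> ('a \<times> 'a) set \<Rightarrow> bool" where
  "learns V E Is D \<longleftrightarrow>
     (\<forall>D'. causal_graph_with_skeleton V E D' \<and> immoralities D' = immoralities D \<and>
           agree_on_cut_edges E Is D D' \<longrightarrow> D' = D)"

definition learns_any :: "'a set \<Rightarrow> 'a set set \<Rightarrow> 'a set list \<Rightarrow> bool" where
  "learns_any V E Is \<longleftrightarrow> (\<forall>D. causal_graph_with_skeleton V E D \<longrightarrow> learns V E Is D)"

definition optimal_design :: "'a set \<Rightarrow> 'a set set \<Rightarrow> ('a \<Rightarrow> real) \<Rightarrow> 'a set list \<Rightarrow> bool" where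
  "optimal_design V E w Is \<longleftrightarrow>
     design V Is \<and> learns_any V E Is \<and>
     (\<forall>Js. design V Js \<and> learns_any V E Js \<longrightarrow> total_cost w Is \<le> total_cost w Js)"

definition color_classes :: "'a set \<Rightarrow> nat \<Rightarrow> ('a \<Rightarrow> nat) \<Rightarrow> 'a set list" where
  "color_classes W k c = map (\<lambda>i. {v \<in> W. c v = i}) [1..<Suc k]"

end

(* A design that separates every edge determines the graph. Conversely, it must separate every
   edge {u, v}: by Dirac's lemma every clique of a chordal graph that is not the whole vertex
   set is avoided by some simplicial vertex, so the vertices can be ordered starting with u, v
   in such a way that the earlier neighbours of each vertex form a clique. Orienting along this
   order, and along the same order with u and v exchanged, gives two graphs without immoralities
   that differ only on {u, v}. Hence the vertices that are never intervened on form an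
   independent set, and the cost is at least the weight of the complement of a maximum weight
   independent set. *)
theory Submission
  imports Defs
begin

section \<open>Cliques, neighbourhoods and adjacency inside a vertex set\<close>

definition clique :: "'a set set \<Rightarrow> 'a set \<Rightarrow> bool" where
  "clique E K \<longleftrightarrow> (\<forall>x\<in>K. \<forall>y\<in>K. x \<noteq> y \<longrightarrow> {x, y} \<in> E)"

definition nbrs :: "'a set set \<Rightarrow> 'a \<Rightarrow> 'a set" where
  "nbrs E x = {y. {x, y} \<in> E}"

text \<open>Adjacency as a relation on vertices, so that connectedness inside \<open>W\<close> can
  be expressed by a reflexive transitive closure.\<close>

definition adj_within :: "'a set set \<Rightarrow> 'a set \<Rightarrow> ('a \<times> 'a) set" where
  "adj_within E W = {(x, y). x \<in> W \<and> y \<in> W \<and> {x, y} \<in> E}"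

lemma clique_mono: "clique E K \<Longrightarrow> L \<subseteq> K \<Longrightarrow> clique E L"
  by (auto simp: clique_def)

lemma edge_irrefl:
  assumes "\<forall>e\<in>E. card e = 2"
  shows "{x, x} \<notin> E"
  using assms by force

lemma nbrs_sym: "x \<in> nbrs E y \<longleftrightarrow> y \<in> nbrs E x"
  by (simp add: nbrs_def insert_commute)

lemma sym_adj_within: "sym (adj_within E W)"
  by (auto simp: adj_within_def sym_def insert_commute)

section \<open>Shortest paths and chordless cycles\<close>

text \<open>A repeated vertex, or a step of \<open>R\<close> that jumps ahead on the path, would
  yield a shorter walk. For a symmetric \<open>R\<close> the last conclusion says that the path is
  induced.\<close>

lemma shortest_path:
  assumes "(x, y) \<in> R\<^sup>*"
  obtains f n where "f 0 = x" "f n = y" "\<And>i. i < n \<Longrightarrow> (f i, f (Suc i)) \<in> R"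
    "inj_on f {..n}" "\<And>i j. i < j \<Longrightarrow> j \<le> n \<Longrightarrow> (f i, f j) \<in> R \<Longrightarrow> j = Suc i"
proof -
  define n where "n = (LEAST n. (x, y) \<in> R ^^ n)"
  have "\<exists>n. (x, y) \<in> R ^^ n"
    using assms by (simp add: rtrancl_power)
  then have "(x, y) \<in> R ^^ n"
    unfolding n_def by (rule LeastI_ex)
  then obtain f where f: "f 0 = x" "f n = y" "\<And>i. i < n \<Longrightarrow> (f i, f (Suc i)) \<in> R"
    by (auto simp: relpow_fun_conv)
  have seg: "(f i, f (i + d)) \<in> R ^^ d" if "i + d \<le> n" for i d
    using that by (auto simp: relpow_fun_conv intro!: exI[of _ "\<lambda>k. f (i + k)"] f)
  \<comment> \<open>Replacing the stretch from \<open>f i\<close> to \<open>f j\<close> by a walk of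
    \<open>m\<close> steps cannot beat the minimum \<open>n\<close>. The case \<open>m = 0\<close>
    gives injectivity, and \<open>m = 1\<close> excludes shortcuts.\<close>
  have short: "j - i \<le> m" if "i \<le> j" "j \<le> n" "(f i, f j) \<in> R ^^ m" for i j m
  proof -
    have "(x, f i) \<in> R ^^ i" "(f j, y) \<in> R ^^ (n - j)"
      using seg[of 0 i] seg[of j "n - j"] that f by simp_all
    then have "(x, y) \<in> R ^^ (i + m + (n - j))"
      using that by (meson relpow_trans)
    then have "n \<le> i + m + (n - j)"
      unfolding n_def by (rule Least_le)
    then show ?thesis using that by simp
  qed
  have "inj_on f {..n}"
  proof (rule linorder_inj_onI')
    fix i j assume "i \<in> {..n}" "j \<in> {..n}" "i < j"
    then show "f i \<noteq> f j" using short[of i j 0] by auto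
  qed
  moreover have "j = Suc i" if "i < j" "j \<le> n" "(f i, f j) \<in> R" for i j
    using short[of i j 1] that by simp
  ultimately show ?thesis using that f by blast
qed

text \<open>Otherwise a shortest path from \<open>x\<close> to \<open>y\<close> through
  \<open>C\<close>, closed up by \<open>v\<close>, would be a cycle on at least four vertices. The
  path has no shortcut and \<open>v\<close> has no neighbour in \<open>C\<close>, so this cycle
  would be chordless.\<close>

lemma chordal_common_neighbours_adjacent:
  assumes "chordal E" and E: "\<forall>e\<in>E. card e = 2"
    and vx: "x \<in> nbrs E v" and vy: "y \<in> nbrs E v" and "x \<noteq> y"
    and C: "C \<inter> nbrs E v = {}" "v \<notin> C"
    and conn: "(x, y) \<in> (adj_within E (insert x (insert y C)))\<^sup>*"
  shows "{x, y} \<in> E"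
proof (rule ccontr)
  assume nadj: "{x, y} \<notin> E"
  let ?W = "insert x (insert y C)"
  obtain f n where f: "f 0 = x" "f n = y" "\<And>i. i < n \<Longrightarrow> (f i, f (Suc i)) \<in> adj_within E ?W"
    and inj: "inj_on f {..n}"
    and ind: "\<And>i j. i < j \<Longrightarrow> j \<le> n \<Longrightarrow> (f i, f j) \<in> adj_within E ?W \<Longrightarrow> j = Suc i"
    by (rule shortest_path[OF conn]) blast
  have "n \<noteq> 0" using f \<open>x \<noteq> y\<close> by metis
  moreover have "n \<noteq> 1" using f(1,2) f(3)[of 0] nadj by (auto simp: adj_within_def)
  ultimately have n: "2 \<le> n" by simp
  have fW: "f i \<in> ?W" if "i \<le> n" for i
    using f(2) f(3)[of i] that by (cases "i = n") (auto simp: adj_within_def)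
  have vW: "v \<notin> ?W"
    using C vx vy edge_irrefl[OF E] by (auto simp: nbrs_def)
  have vf: "i = 0 \<or> i = n" if "i \<le> n" "{v, f i} \<in> E" for i
  proof -
    have "f i \<notin> C" using that C by (auto simp: nbrs_def)
    then have "f i = f 0 \<or> f i = f n" using fW that f by auto
    then show ?thesis using inj that by (auto dest!: inj_onD)
  qed
  define xs where "xs = map f [0..<Suc n] @ [v]"
  have len: "length xs = n + 2" by (simp add: xs_def)
  have nth: "xs ! i = (if i \<le> n then f i else v)" if "i < n + 2" for i
    using that by (auto simp: xs_def nth_append simp del: upt_Suc)
  have set: "set xs = insert v (f ` {..n})"
    by (auto simp: xs_def simp del: upt_Suc)
  \<comment> \<open>The two closing edges come from index \<open>n\<close>, whose successor is
    \<open>v\<close>, and from index \<open>n + 1\<close>, which wraps around to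
    \<open>f 0\<close>.\<close>
  have cyc: "cycle_edges xs = insert {f n, v} (insert {v, f 0} {{f i, f (Suc i)} | i. i < n})"
    (is "_ = ?R")
  proof
    have step: "xs ! (Suc i mod (n + 2)) = (if i < n then f (Suc i) else if i = n then v else f 0)"
      if "i < n + 2" for i
    proof (cases "i = Suc n")
      case True
      then show ?thesis by (simp add: nth)
    next
      case False
      then have "Suc i < n + 2" using that by simp
      then have "Suc i mod (n + 2) = Suc i" by (rule mod_less)
      then show ?thesis using nth[OF \<open>Suc i < n + 2\<close>] False that by simp
    qed
    have eq: "cycle_edges xs = {{xs ! i, xs ! (Suc i mod (n + 2))} | i. i < n + 2}"
      unfolding cycle_edges_def len ..
    show "cycle_edges xs \<subseteq> ?R"
    proof
      fix e assume "e \<in> cycle_edges xs"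
      then obtain i where i: "i < n + 2" "e = {xs ! i, xs ! (Suc i mod (n + 2))}"
        unfolding eq by blast
      consider "i < n" | "i = n" | "i = Suc n" using i by linarith
      then show "e \<in> ?R"
        using i(2) nth[OF i(1)] step[OF i(1)] by cases auto
    qed
    have mem: "{xs ! i, xs ! (Suc i mod (n + 2))} \<in> cycle_edges xs" if "i < n + 2" for i
      unfolding eq using that by blast
    have "{f i, f (Suc i)} \<in> cycle_edges xs" if "i < n" for i
      using mem[of i] nth[of i] step[of i] that by simp
    moreover have "{f n, v} \<in> cycle_edges xs"
      using mem[of n] nth[of n] step[of n] by simp
    moreover have "{v, f 0} \<in> cycle_edges xs"
      using mem[of "Suc n"] nth[of "Suc n"] step[of "Suc n"] by simp
    ultimately show "?R \<subseteq> cycle_edges xs" by blast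
  qed
  have "cycle_edges xs \<subseteq> E"
    using f vx vy by (auto simp: cyc adj_within_def nbrs_def insert_commute)
  moreover have "distinct xs"
    using inj fW vW by (auto simp: xs_def distinct_map atMost_upto[symmetric]
        atLeast0LessThan lessThan_Suc_atMost simp del: upt_Suc)
  moreover have "3 \<le> length xs" "4 \<le> length xs" using n len by auto
  ultimately obtain e where e: "e \<in> E" "e \<subseteq> set xs" "e \<notin> cycle_edges xs"
    using assms(1) unfolding chordal_def is_cycle_def by blast
  obtain p q where pq: "e = {p, q}" "p \<noteq> q"
    using E e(1) by (meson card_2_iff)
  \<comment> \<open>A chord either ends in \<open>v\<close> or joins two vertices of the path; both
    kinds turn out to be edges of the cycle itself.\<close>
  have no_v: "\<not> (i \<le> n \<and> e = {v, f i})" for i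
    using vf[of i] e cyc by (auto simp: insert_commute)
  have no_f: "\<not> (i < j \<and> j \<le> n \<and> e = {f i, f j})" for i j
  proof
    assume a: "i < j \<and> j \<le> n \<and> e = {f i, f j}"
    then have "(f i, f j) \<in> adj_within E ?W"
      using fW[of i] fW[of j] e(1) unfolding adj_within_def by auto
    then have "j = Suc i" using ind a by blast
    then have "e \<in> cycle_edges xs" using a unfolding cyc by auto
    then show False using e(3) by contradiction
  qed
  have "p \<in> insert v (f ` {..n})" "q \<in> insert v (f ` {..n})"
    using pq e(2) set by auto
  then consider "p = v" "q \<in> f ` {..n}" | "q = v" "p \<in> f ` {..n}"
    | "p \<in> f ` {..n}" "q \<in> f ` {..n}"
    using pq by blast
  then show False
  proof cases
    case 3
    then obtain i j where "i \<le> n" "j \<le> n" "p = f i" "q = f j" by auto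
    then show False
      using no_f[of i j] no_f[of j i] pq by (metis insert_commute nat_neq_iff)
  qed (use no_v pq in \<open>auto simp: insert_commute\<close>)
qed

section \<open>Simplicial vertices of chordal graphs\<close>

definition simplicial :: "'a set set \<Rightarrow> 'a set \<Rightarrow> 'a \<Rightarrow> bool" where
  "simplicial E W s \<longleftrightarrow> clique E (W \<inter> nbrs E s)"

text \<open>Dirac's lemma in a form that supports induction. If \<open>W\<close> is a clique, any
  vertex outside \<open>K\<close> works. Otherwise take \<open>v\<close> with a non-neighbour
  \<open>a\<close> and with \<open>K\<close> inside its closed neighbourhood: the component of
  \<open>a\<close> away from \<open>v\<close> has a clique as boundary, and the induction hypothesis
  finds a simplicial vertex in that component.\<close>

lemma chordal_simplicial_avoiding_clique:
  assumes "chordal E" and E: "\<forall>e\<in>E. card e = 2"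
    and "finite W" "K \<subset> W" "clique E K"
  shows "\<exists>s\<in>W - K. simplicial E W s"
  using assms(3-)
proof (induction W arbitrary: K rule: finite_psubset_induct)
  case (psubset W)
  show ?case
  proof (cases "clique E W")
    case True
    then show ?thesis
      using psubset.prems clique_mono[of E W] by (fastforce simp: simplicial_def)
  next
    case False
    then obtain p q where pq: "p \<in> W" "q \<in> W" "p \<noteq> q" "{p, q} \<notin> E"
      by (auto simp: clique_def)
    obtain v a where va: "v \<in> W" "a \<in> W" "a \<noteq> v" "a \<notin> nbrs E v"
      and Kv: "K \<subseteq> insert v (nbrs E v)"
    \<comment> \<open>If a member of \<open>K\<close> misses some vertex of \<open>W\<close>, it
      serves as \<open>v\<close>. Otherwise every member of \<open>K\<close> is adjacent to all the
      rest of \<open>W\<close>, so \<open>p\<close> with its non-neighbour \<open>q\<close> will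
      do.\<close>
    proof (cases "\<exists>v\<in>K. \<exists>a\<in>W. a \<noteq> v \<and> a \<notin> nbrs E v")
      case True
      then obtain v a where "v \<in> K" "a \<in> W" "a \<noteq> v" "a \<notin> nbrs E v" by blast
      moreover from this have "v \<in> W" "K \<subseteq> insert v (nbrs E v)"
        using psubset.prems by (auto simp: clique_def nbrs_def)
      ultimately show ?thesis using that[of v a] by blast
    next
      case False
      then have "K \<subseteq> insert p (nbrs E p)"
        using pq(1) nbrs_sym by fastforce
      then show ?thesis using that[of p q] pq by (simp add: nbrs_def)
    qed
    \<comment> \<open>\<open>C\<close> is the component of \<open>a\<close> among the vertices
      neither equal nor adjacent to \<open>v\<close>, and \<open>B\<close> is its boundary in
      \<open>W\<close>. A vertex of \<open>W - U\<close> is \<open>v\<close> or a neighbour of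
      \<open>v\<close>, and \<open>v\<close> has no neighbour in \<open>U\<close>, so
      \<open>B\<close> consists of neighbours of \<open>v\<close>.\<close>
    define U where "U = W - insert v (nbrs E v)"
    define C where "C = {z. (a, z) \<in> (adj_within E U)\<^sup>*}"
    define B where "B = {b \<in> W - U. nbrs E b \<inter> C \<noteq> {}}"
    have aU: "a \<in> U" using va by (simp add: U_def)
    have CU: "C \<subseteq> U"
    proof
      fix z assume "z \<in> C"
      then show "z \<in> U"
        using aU unfolding C_def by (auto elim: rtranclE simp: adj_within_def)
    qed
    have aC: "a \<in> C" by (simp add: C_def)
    have Cstep: "z' \<in> C" if "z \<in> C" "z' \<in> U" "{z, z'} \<in> E" for z z'
      using that CU by (auto simp: C_def adj_within_def intro: rtrancl_into_rtrancl)
    have Cnbrs: "W \<inter> nbrs E z \<subseteq> C \<union> B" if "z \<in> C" for z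
      using Cstep[OF that] that nbrs_sym by (fastforce simp: B_def nbrs_def insert_commute)
    have CBW: "C \<union> B \<subseteq> W" using CU by (auto simp: B_def U_def)
    have vCB: "v \<notin> C \<union> B" and Bv: "B \<subseteq> nbrs E v"
      using CU by (auto simp: B_def U_def nbrs_def insert_commute)
    \<comment> \<open>Two vertices of \<open>B\<close> are common neighbours of \<open>v\<close>
      that are joined through \<open>C\<close>, by way of \<open>a\<close>; chordality makes them
      adjacent.\<close>
    have "clique E B"
      unfolding clique_def
    proof (intro ballI impI)
      fix x y assume xy: "x \<in> B" "y \<in> B" "x \<noteq> y"
      let ?R = "adj_within E (insert x (insert y C))"
      obtain x' y' where x'y': "x' \<in> C" "{x, x'} \<in> E" "y' \<in> C" "{y, y'} \<in> E"
        using xy by (auto simp: B_def nbrs_def)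
      have reach: "(a, z) \<in> ?R\<^sup>*" if "z \<in> C" for z
      proof -
        have "(a, z) \<in> (adj_within E U)\<^sup>*" using that by (simp add: C_def)
        then show ?thesis
        proof (induction rule: rtrancl_induct)
          case (step z z')
          then have "z \<in> C" "z' \<in> C"
            by (auto simp: C_def intro: rtrancl_into_rtrancl)
          with step show ?case
            by (auto simp: adj_within_def intro!: rtrancl_into_rtrancl[of a z])
        qed simp
      qed
      have "sym (?R\<^sup>*)" by (intro sym_rtrancl sym_adj_within)
      then have "(x', a) \<in> ?R\<^sup>*" using reach x'y' by (meson symD)
      moreover have "(x, x') \<in> ?R" "(y', y) \<in> ?R"
        using x'y' by (auto simp: adj_within_def insert_commute)
      ultimately have "(x, y) \<in> ?R\<^sup>*"
        using reach[OF x'y'(3)]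
        by (meson converse_rtrancl_into_rtrancl rtrancl_into_rtrancl rtrancl_trans)
      then show "{x, y} \<in> E"
        using chordal_common_neighbours_adjacent[OF assms(1) E, of x v y C] xy Bv CU
        by (auto simp: U_def)
    qed
    moreover have "B \<subset> C \<union> B" using aC CU by (auto simp: B_def)
    moreover have "C \<union> B \<subset> W" using CBW vCB va(1) by blast
    \<comment> \<open>The set \<open>C \<union> B\<close> is smaller than \<open>W\<close> because
      it misses \<open>v\<close>. Avoiding \<open>B\<close> forces \<open>s\<close> into
      \<open>C\<close>, which is disjoint from the closed neighbourhood of \<open>v\<close> and
      hence from \<open>K\<close>.\<close>
    ultimately obtain s where s: "s \<in> C" "s \<notin> B" "simplicial E (C \<union> B) s"
      using psubset.IH[of "C \<union> B" B] by blast
    have "s \<in> W - K" using s(1) CU Kv by (auto simp: U_def)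
    \<comment> \<open>A vertex of \<open>C\<close> has no neighbours in \<open>W\<close> beyond
      \<open>C \<union> B\<close>, so nothing new has to be checked in \<open>W\<close>.\<close>
    moreover have "simplicial E W s"
      using s(3) Cnbrs[OF s(1)] unfolding simplicial_def by (auto elim: clique_mono)
    ultimately show ?thesis by blast
  qed
qed

section \<open>Perfect rankings starting with a given edge\<close>

text \<open>Nothing is required at \<open>u\<close> and \<open>v\<close> themselves, which keeps the condition
  invariant under exchanging their ranks.\<close>
definition perfect_ranking :: "'a set \<Rightarrow> 'a set set \<Rightarrow> 'a \<Rightarrow> 'a \<Rightarrow> ('a \<Rightarrow> nat) \<Rightarrow> bool" where
  "perfect_ranking W E u v r \<longleftrightarrow> inj_on r W \<and> r u = 0 \<and> r v = 1 \<and>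
     (\<forall>z\<in>W - {u, v}. clique E {x \<in> W \<inter> nbrs E z. r x < r z})"

text \<open>All vertices of \<open>W\<close> other than \<open>u\<close> and \<open>v\<close> have
  rank at least 2, so exchanging the ranks 0 and 1 affects only the comparison of \<open>u\<close>
  with \<open>v\<close>. The earlier neighbours of every other vertex stay the same.\<close>

lemma perfect_ranking_swap:
  assumes "perfect_ranking W E u v r" "u \<in> W" "v \<in> W"
  shows "perfect_ranking W E v u (r(u := 1, v := 0))"
    and "\<And>x y. x \<in> W \<Longrightarrow> y \<in> W \<Longrightarrow> {x, y} \<noteq> {u, v} \<Longrightarrow>
      (r(u := 1, v := 0)) x < (r(u := 1, v := 0)) y \<longleftrightarrow> r x < r y"
proof -
  let ?r = "r(u := 1, v := 0)"
  have r: "inj_on r W" "r u = 0" "r v = 1"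
    using assms by (auto simp: perfect_ranking_def)
  then have uv: "u \<noteq> v" by auto
  have ge2: "2 \<le> r z" if "z \<in> W - {u, v}" for z
  proof -
    have "r z \<noteq> r u" "r z \<noteq> r v" using that r(1) assms(2,3) by (auto dest: inj_onD)
    then show ?thesis using r by simp
  qed
  show less: "?r x < ?r y \<longleftrightarrow> r x < r y" if "x \<in> W" "y \<in> W" "{x, y} \<noteq> {u, v}" for x y
    using that r uv ge2[of x] ge2[of y] by (cases "x \<in> {u, v}"; cases "y \<in> {u, v}") auto
  have inj: "inj_on ?r W"
  proof (rule inj_onI)
    fix x y assume "x \<in> W" "y \<in> W" "?r x = ?r y"
    then show "x = y"
      using r uv ge2[of x] ge2[of y]
      by (cases "x \<in> {u, v}"; cases "y \<in> {u, v}") (auto dest: inj_onD split: if_splits)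
  qed
  have eq: "{x \<in> W \<inter> nbrs E z. ?r x < ?r z} = {x \<in> W \<inter> nbrs E z. r x < r z}"
    if "z \<in> W - {u, v}" for z
  proof -
    have "?r x < ?r z \<longleftrightarrow> r x < r z" if "x \<in> W" for x
      using less[of x z] that \<open>z \<in> W - {u, v}\<close> by blast
    then show ?thesis by blast
  qed
  have "clique E {x \<in> W \<inter> nbrs E z. ?r x < ?r z}" if "z \<in> W - {v, u}" for z
    using eq[of z] assms(1) that by (auto simp: perfect_ranking_def insert_commute)
  then show "perfect_ranking W E v u ?r"
    using inj uv by (simp add: perfect_ranking_def)
qed

text \<open>As long as other vertices remain, one of them is simplicial, because the edge
  \<open>{u, v}\<close> is a clique that can be avoided. It is ranked last, after a ranking of the
  rest.\<close>

lemma chordal_perfect_ranking: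
  assumes "chordal E" and E: "\<forall>e\<in>E. card e = 2" and "finite W" "{u, v} \<in> E" "u \<in> W" "v \<in> W"
  shows "\<exists>r. perfect_ranking W E u v r"
  using assms(3,5,6)
proof (induction W rule: finite_psubset_induct)
  case (psubset W)
  have uv: "u \<noteq> v" using assms(4) edge_irrefl[OF E] by auto
  show ?case
  proof (cases "W = {u, v}")
    case True
    then show ?thesis
      using uv by (auto simp: perfect_ranking_def intro!: exI[of _ "\<lambda>x. if x = u then 0 else 1"])
  next
    case False
    then have "{u, v} \<subset> W" using psubset.prems by blast
    moreover have "clique E {u, v}"
      using assms(4) by (auto simp: clique_def insert_commute)
    ultimately obtain s where s: "s \<in> W" "s \<noteq> u" "s \<noteq> v" "simplicial E W s"
      using chordal_simplicial_avoiding_clique[OF assms(1) E psubset.hyps, of "{u, v}"] by blast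
    then obtain r where r: "perfect_ranking (W - {s}) E u v r"
      using psubset.IH[of "W - {s}"] psubset.prems by blast
    \<comment> \<open>The maximum is taken over all of \<open>W\<close>, so \<open>m\<close> exceeds
      every rank in use and \<open>s\<close> comes strictly last. Hence \<open>s\<close> is never an
      earlier neighbour of another vertex.\<close>
    define m where "m = Suc (Max (r ` W))"
    have m: "r x < m" if "x \<in> W" for x
      using psubset.hyps that by (simp add: m_def less_Suc_eq_le)
    let ?r = "r(s := m)"
    have "inj_on ?r W"
    proof (rule inj_onI)
      fix x y assume "x \<in> W" "y \<in> W" "?r x = ?r y"
      then show "x = y"
        using r m[of x] m[of y] unfolding perfect_ranking_def
        by (auto dest: inj_onD split: if_splits)
    qed
    moreover have "clique E {x \<in> W \<inter> nbrs E z. ?r x < ?r z}" if "z \<in> W - {u, v}" for z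
    proof (cases "z = s")
      case True
      then show ?thesis
        using s(4) by (auto simp: simplicial_def elim!: clique_mono)
    next
      case False
      have "clique E {x \<in> (W - {s}) \<inter> nbrs E z. r x < r z}"
        using r that False by (simp add: perfect_ranking_def)
      moreover have "{x \<in> W \<inter> nbrs E z. ?r x < ?r z} \<subseteq> {x \<in> (W - {s}) \<inter> nbrs E z. r x < r z}"
        using m[of z] that False by auto
      ultimately show ?thesis by (rule clique_mono)
    qed
    ultimately have "perfect_ranking W E u v ?r"
      using r s by (simp add: perfect_ranking_def)
    then show ?thesis by blast
  qed
qed

section \<open>Acyclic orientations obtained from rankings\<close>

definition orientation :: "'a set set \<Rightarrow> ('a \<Rightarrow> nat) \<Rightarrow> ('a \<times> 'a) set" where
  "orientation E r = {(x, y). {x, y} \<in> E \<and> r x < r y}"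

lemma skeleton_orientation:
  assumes "fin_graph V E" "inj_on r V"
  shows "skeleton (orientation E r) = E"
proof
  show "skeleton (orientation E r) \<subseteq> E"
    by (auto simp: skeleton_def orientation_def)
  show "E \<subseteq> skeleton (orientation E r)"
  proof
    fix e assume "e \<in> E"
    then have e: "card e = 2" "e \<subseteq> V" using assms(1) by (auto simp: fin_graph_def)
    obtain x y where xy: "e = {x, y}" "x \<noteq> y"
      using e(1) by (auto simp: card_2_iff)
    then have "r x \<noteq> r y" using assms(2) e by (auto dest: inj_onD)
    then have "(x, y) \<in> orientation E r \<or> (y, x) \<in> orientation E r"
      using \<open>e \<in> E\<close> xy by (auto simp: orientation_def insert_commute)
    then show "e \<in> skeleton (orientation E r)"
      using xy by (auto simp: skeleton_def insert_commute)
  qed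
qed

lemma causal_graph_orientation:
  assumes "fin_graph V E" "inj_on r V"
  shows "causal_graph_with_skeleton V E (orientation E r)"
proof -
  have "orientation E r \<subseteq> measure r" by (auto simp: orientation_def)
  then have "acyclic (orientation E r)"
    by (meson acyclic_subset wf_acyclic wf_measure)
  moreover have "orientation E r \<subseteq> V \<times> V"
    using assms(1) by (auto simp: orientation_def fin_graph_def)
  ultimately show ?thesis
    using skeleton_orientation[OF assms] by (simp add: causal_graph_with_skeleton_def)
qed

text \<open>Two distinct tails of arcs into \<open>z\<close> have distinct ranks below that of
  \<open>z\<close>. So \<open>z\<close> has rank at least 2, is neither \<open>u\<close> nor
  \<open>v\<close>, and its earlier neighbours form a clique.\<close>

lemma immoralities_perfect_orientation:
  assumes G: "fin_graph V E" and r: "perfect_ranking V E u v r" and "u \<in> V" "v \<in> V"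
  shows "immoralities (orientation E r) = {}"
proof -
  have inj: "inj_on r V" "r u = 0" "r v = 1" using r by (auto simp: perfect_ranking_def)
  have "{x, y} \<in> E" if xz: "(x, z) \<in> orientation E r" and yz: "(y, z) \<in> orientation E r"
    and "x \<noteq> y" for x y z
  proof -
    have V: "x \<in> V" "y \<in> V" "z \<in> V"
      using xz yz G by (auto simp: orientation_def fin_graph_def)
    have less: "r x < r z" "r y < r z" using xz yz by (auto simp: orientation_def)
    have "r x \<noteq> r y" using inj(1) V \<open>x \<noteq> y\<close> by (auto dest: inj_onD)
    then have "z \<notin> {u, v}" using less inj by auto
    then have "clique E {x \<in> V \<inter> nbrs E z. r x < r z}"
      using r V by (simp add: perfect_ranking_def)
    then show ?thesis
      using V less xz yz \<open>x \<noteq> y\<close>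
      by (auto simp: clique_def nbrs_def orientation_def insert_commute)
  qed
  then show ?thesis
    using skeleton_orientation[OF G inj(1)] by (auto simp: immoralities_def)
qed

section \<open>Learning and separation of edges\<close>

lemma learns_any_separates_edge:
  assumes G: "fin_graph V E" and "chordal E" and learns: "learns_any V E Is" and uv: "{u, v} \<in> E"
  shows "\<exists>I\<in>set Is. (u \<in> I) \<noteq> (v \<in> I)"
proof (rule ccontr)
  assume nosep: "\<not> ?thesis"
  have E: "\<forall>e\<in>E. card e = 2" and "finite V" and V: "u \<in> V" "v \<in> V"
    using G uv by (auto simp: fin_graph_def)
  obtain r where r: "perfect_ranking V E u v r"
    using chordal_perfect_ranking[OF assms(2) E \<open>finite V\<close> uv V] by blast
  define r' where "r' = r(u := 1, v := 0)"
  have r': "perfect_ranking V E v u r'"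
    unfolding r'_def by (rule perfect_ranking_swap[OF r V])
  have same: "r' x < r' y \<longleftrightarrow> r x < r y"
    if "x \<in> V" "y \<in> V" "{x, y} \<noteq> {u, v}" for x y
    unfolding r'_def by (rule perfect_ranking_swap(2)[OF r V that])
  let ?D = "orientation E r" and ?D' = "orientation E r'"
  have "causal_graph_with_skeleton V E ?D" "causal_graph_with_skeleton V E ?D'"
    using causal_graph_orientation[OF G] r r' by (auto simp: perfect_ranking_def)
  moreover have "immoralities ?D' = immoralities ?D"
    using immoralities_perfect_orientation[OF G] r r' V by metis
  moreover have "agree_on_cut_edges E Is ?D ?D'"
    unfolding agree_on_cut_edges_def
  proof (intro ballI allI impI)
    fix I x y assume I: "I \<in> set Is" and xy: "{x, y} \<in> E \<and> x \<in> I \<and> y \<notin> I"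
    \<comment> \<open>An intervention that cuts \<open>{x, y}\<close> separates its endpoints, while
      none separates \<open>u\<close> from \<open>v\<close>. So the cut edge is one on which both
      rankings agree.\<close>
    then have "{x, y} \<noteq> {u, v}" using nosep by (auto simp: doubleton_eq_iff)
    moreover have "x \<in> V" "y \<in> V" using xy G by (auto simp: fin_graph_def)
    ultimately show "((x, y) \<in> ?D \<longleftrightarrow> (x, y) \<in> ?D') \<and> ((y, x) \<in> ?D \<longleftrightarrow> (y, x) \<in> ?D')"
      using same[of x y] same[of y x] by (auto simp: orientation_def insert_commute)
  qed
  ultimately have "?D' = ?D"
    using learns by (auto simp: learns_any_def learns_def)
  moreover have "(u, v) \<in> ?D" "(u, v) \<notin> ?D'"
    using uv r r' by (auto simp: orientation_def perfect_ranking_def)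
  ultimately show False by blast
qed

text \<open>Every edge is a cut edge here, so agreement on the cut edges fixes every arc.\<close>

lemma separating_learns_any:
  assumes sep: "\<And>x y. {x, y} \<in> E \<Longrightarrow> \<exists>I\<in>set Is. (x \<in> I) \<noteq> (y \<in> I)"
  shows "learns_any V E Is"
  unfolding learns_any_def learns_def
proof (intro allI impI)
  fix D D'
  assume D: "causal_graph_with_skeleton V E D"
    and D': "causal_graph_with_skeleton V E D' \<and> immoralities D' = immoralities D \<and>
      agree_on_cut_edges E Is D D'"
  have eq: "(x, y) \<in> D \<longleftrightarrow> (x, y) \<in> D'" if xy: "{x, y} \<in> E" for x y
  proof -
    obtain I where "I \<in> set Is" "(x \<in> I) \<noteq> (y \<in> I)" using sep[OF xy] by blast
    moreover have "{y, x} \<in> E" using xy by (simp add: insert_commute)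
    ultimately show ?thesis
      using D' xy unfolding agree_on_cut_edges_def by (cases "x \<in> I") blast+
  qed
  have "{x, y} \<in> E" if "(x, y) \<in> D \<union> D'" for x y
    using D D' that unfolding causal_graph_with_skeleton_def skeleton_def by blast
  then show "D' = D" using eq by auto
qed

section \<open>Costs of designs\<close>

text \<open>A vertex in several interventions is paid for repeatedly, which for nonnegative weights
  can only increase the cost.\<close>

lemma sum_Union_le_total_cost:
  assumes "finite V" "design V Is" "\<forall>v\<in>V. w v \<ge> 0"
  shows "sum w (\<Union>(set Is)) \<le> total_cost w Is"
  using assms(2)
proof (induction Is)
  case Nil
  then show ?case by (simp add: total_cost_def)
next
  case (Cons I Is)
  let ?U = "\<Union>(set Is)"
  have sub: "I \<subseteq> V" "?U \<subseteq> V" using Cons.prems by (auto simp: design_def)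
  then have fin: "finite I" "finite ?U" using assms(1) finite_subset by blast+
  have "sum w (I \<inter> ?U) \<ge> 0" using assms(3) sub by (intro sum_nonneg) blast
  then have "sum w (I \<union> ?U) \<le> sum w I + sum w ?U"
    using sum_Un[OF fin, of w] by simp
  also have "\<dots> \<le> total_cost w (I # Is)"
    using Cons by (simp add: total_cost_def design_def)
  finally show ?case by simp
qed

text \<open>The classes partition \<open>W\<close>, so each vertex is paid for exactly once; empty
  classes cost nothing.\<close>

lemma total_cost_color_classes:
  assumes "finite W" "\<forall>v\<in>W. c v \<in> {1..k}"
  shows "total_cost w (color_classes W k c) = sum w W"
proof -
  have "total_cost w (color_classes W k c) = (\<Sum>i = 1..k. sum w {v \<in> W. c v = i})"
    unfolding total_cost_def color_classes_def
    by (simp add: comp_def interv_sum_list_conv_sum_set_nat atLeastLessThanSuc_atLeastAtMost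
        del: upt_Suc)
  also have "\<dots> = sum w W"
    using assms by (intro sum.group) auto
  finally show ?thesis .
qed

section \<open>Optimality of the coloring design\<close>

theorem theorem2:
  fixes V :: "'a set" and E :: "'a set set" and w :: "'a \<Rightarrow> real"
    and \<chi> :: nat and S :: "'a set" and c :: "'a \<Rightarrow> nat"
  assumes "fin_graph V E"
    and "chordal E"
    and "\<chi> = chromatic_number V E"
    and "\<forall>v\<in>V. w v \<ge> 0"
    and "max_weight_independent_set V E w S"
    and "proper_coloring (V - S) (induced_edges E (V - S)) \<chi> c"
  shows "optimal_design V E w (color_classes (V - S) \<chi> c)"
proof -
  let ?Is = "color_classes (V - S) \<chi> c"
  have finV: "finite V" and edge: "\<And>x y. {x, y} \<in> E \<Longrightarrow> x \<in> V \<and> y \<in> V"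
    using assms(1) by (auto simp: fin_graph_def)
  have irrefl: "\<And>x. {x, x} \<notin> E"
    using assms(1) by (intro edge_irrefl) (auto simp: fin_graph_def)
  have S: "independent_set V E S" "S \<subseteq> V" "\<And>T. independent_set V E T \<Longrightarrow> sum w T \<le> sum w S"
    using assms(5) by (auto simp: max_weight_independent_set_def independent_set_def)
  have col: "\<forall>v\<in>V - S. c v \<in> {1..\<chi>}"
    and proper: "\<And>x y. x \<in> V - S \<Longrightarrow> y \<in> V - S \<Longrightarrow> {x, y} \<in> E \<Longrightarrow> c x \<noteq> c y"
    using assms(6) by (auto simp: proper_coloring_def induced_edges_def)
  have classes: "set ?Is = (\<lambda>i. {v \<in> V - S. c v = i}) ` {1..\<chi>}"
    by (auto simp: color_classes_def simp del: upt_Suc)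
  \<comment> \<open>The witness is the color class of \<open>x\<close>. It omits \<open>y\<close>
    either because the coloring is proper or because \<open>y\<close> lies in \<open>S\<close> and
    hence in no class.\<close>
  have sep1: "\<exists>I\<in>set ?Is. x \<in> I \<and> y \<notin> I" if "{x, y} \<in> E" "x \<notin> S" for x y
  proof
    have "x \<in> V" "y \<in> V" using edge that by auto
    then show "{v \<in> V - S. c v = c x} \<in> set ?Is"
      using col that classes by blast
    show "x \<in> {v \<in> V - S. c v = c x} \<and> y \<notin> {v \<in> V - S. c v = c x}"
      using proper[of x y] that \<open>x \<in> V\<close> by auto
  qed
  have learns: "learns_any V E ?Is"
  proof (rule separating_learns_any)
    fix x y assume xy: "{x, y} \<in> E"
    then have "x \<notin> S \<or> y \<notin> S" using S(1) by (auto simp: independent_set_def)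
    then show "\<exists>I\<in>set ?Is. (x \<in> I) \<noteq> (y \<in> I)"
      using sep1[of x y] sep1[of y x] xy by (auto simp: insert_commute)
  qed
  have "total_cost w ?Is \<le> total_cost w Js" if Js: "design V Js" "learns_any V E Js" for Js
  proof -
    let ?U = "\<Union>(set Js)"
    have U: "?U \<subseteq> V" using Js(1) by (auto simp: design_def)
    have "independent_set V E (V - ?U)"
      using learns_any_separates_edge[OF assms(1,2) Js(2)]
      by (fastforce simp: independent_set_def)
    then have "sum w (V - ?U) \<le> sum w S" by (rule S(3))
    \<comment> \<open>Taking complements in \<open>V\<close> turns the maximality of
      \<open>S\<close> into a lower bound on the weight of the vertices that \<open>Js\<close>
      touches.\<close>
    then have "sum w (V - S) \<le> sum w ?U"
      using sum_diff[OF finV U, of w] sum_diff[OF finV S(2), of w] by simp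
    also have "\<dots> \<le> total_cost w Js"
      by (rule sum_Union_le_total_cost[OF finV Js(1) assms(4)])
    finally show ?thesis
      using total_cost_color_classes[of "V - S" c \<chi> w] finV col by simp
  qed
  moreover have "design V ?Is" using classes by (auto simp: design_def)
  ultimately show ?thesis using learns by (simp add: optimal_design_def)
qed

end
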